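(* There exists an inter-class orthogonal plan for a $3^6$ experiment on eighteen blocks of size four each estimating all main effects and all but nine two-factor interactions.
   Context: $F=\{0,1,2\}$ is the field of order $3$. A run of a $3^m$ experiment is a vector $x\in F^m$ ($x_i$ is the level of the $i$th factor). A plan consists of a list of blocks, each a list of runs. For $a\in F^m\setminus\{0\}$, $E_a$ denotes the factorial effect given by $a$, with $E_a=E_{2a}$; run $x$ is at level $t$ of $E_a$ if $a'x=t$. $E_a$ is a main effect if $a$ has exactly one non-zero entry, and a two-factor interaction if $a$ has exactly two non-zero entries (so $A_iA_j$ and $A_iA_j^2$ count as two different two-factor interactions, each with 2 degrees of freedom; for $m=6$ there are 30 two-factor interactions). All interactions involving three or more factors are assumed absent. An effect is confounded with the block factor if within each block all runs are at the same level of that effect. Orthogonality through the block factor (all blocks of size $k$): $E_a$ and $E_b$ are orthogonal if $kN^{ab}=L^a(L^b)'$, where $N^{ab}$ has $(\alpha,\beta)$ entry the number of runs $x$ of the plan with $a'x=\alpha$, $b'x=\beta$, and $L^a$ has $(\alpha,j)$ entry the number of runs $x$ in block $j$ with $a'x=\alpha$. A plan is inter-class orthogonal if the set of all effects of interest (here: all main effects and two-factor interactions not confounded with the block factor) can be divided into several classes such that every effect is orthogonal (through the block factor) to every effect from a different class. A plan estimates a set $S$ of effects if, in the linear model in which the expected response of a run $x$ in block $j$ is $\mu+\beta_j+\sum_{E_a\in S}\theta^a_{a'x}$ (general effect, block effects, and effects of the levels of the members of $S$), every contrast $\sum_{t\in F} l_t\theta^a_t$ with $\sum_t l_t=0$,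 $E_a\in S$, is estimable. In the claim, $S$ consists of all 6 main effects and 21 of the 30 two-factor interactions. *)

theory Defs
  imports "HOL-Analysis.Finite_Cartesian_Product" "HOL-Library.Numeral_Type"
    "HOL-Library.Disjoint_Sets"
begin

text \<open>The field of order 3 is the numeral type \<^typ>\<open>3\<close> of integers modulo 3, and a run of a
  $3^m$ experiment is a vector indexed by a type \<^typ>\<open>'m\<close> with $m$ elements.\<close>

type_synonym 'm run = "3 ^ 'm"
type_synonym 'm plan = "'m run list list"

definition level :: "3 ^ 'm::finite \<Rightarrow> 'm run \<Rightarrow> 3" where
  "level a x = (\<Sum>i\<in>UNIV. a $ i * x $ i)"

text \<open>Since $E_a = E_{2a}$, the effect $E_a$ is represented by the set $\{a, 2a\}$.  Replacing
  \<open>a\<close> by \<open>2a\<close> only relabels the levels of the effect.\<close>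

type_synonym 'm effect = "(3 ^ 'm) set"

definition effect :: "3 ^ 'm::finite \<Rightarrow> 'm effect" where
  "effect a = {a, 2 *s a}"

definition weight :: "3 ^ 'm::finite \<Rightarrow> nat" where
  "weight a = card {i. a $ i \<noteq> 0}"

definition main_effects :: "('m::finite) effect set" where
  "main_effects = effect ` {a. weight a = 1}"

definition two_factor_interactions :: "('m::finite) effect set" where
  "two_factor_interactions = effect ` {a. weight a = 2}"

definition confounded :: "'m::finite plan \<Rightarrow> 'm effect \<Rightarrow> bool" where
  "confounded P E \<longleftrightarrow>
     (\<forall>a\<in>E. \<forall>b\<in>set P. \<forall>x\<in>set b. \<forall>y\<in>set b. level a x = level a y)"

definition effects_of_interest :: "'m::finite plan \<Rightarrow> 'm effect set" where
  "effects_of_interest P = {E \<in> main_effects \<union> two_factor_interactions. \<not> confounded P E}"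

text \<open>The incidence matrices $N^{ab}$ (level by level) and $L^a$ (level by block), counting runs
  with multiplicity.\<close>

definition N_mat :: "'m::finite plan \<Rightarrow> 3 ^ 'm \<Rightarrow> 3 ^ 'm \<Rightarrow> 3 \<Rightarrow> 3 \<Rightarrow> nat" where
  "N_mat P a b \<alpha> \<beta> =
     length (filter (\<lambda>x. level a x = \<alpha> \<and> level b x = \<beta>) (concat P))"

definition L_mat :: "'m::finite plan \<Rightarrow> 3 ^ 'm \<Rightarrow> 3 \<Rightarrow> nat \<Rightarrow> nat" where
  "L_mat P a \<alpha> j = length (filter (\<lambda>x. level a x = \<alpha>) (P ! j))"

definition orthogonal_through_blocks ::
    "nat \<Rightarrow> 'm::finite plan \<Rightarrow> 'm effect \<Rightarrow> 'm effect \<Rightarrow> bool" where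
  "orthogonal_through_blocks k P E G \<longleftrightarrow>
     (\<forall>a\<in>E. \<forall>b\<in>G. \<forall>\<alpha> \<beta>.
        k * N_mat P a b \<alpha> \<beta> = (\<Sum>j<length P. L_mat P a \<alpha> j * L_mat P b \<beta> j))"

text \<open>There must be at least two classes, as with a single class the condition would be void;
  \<^const>\<open>partition_on\<close> makes all classes nonempty.\<close>

definition inter_class_orthogonal :: "nat \<Rightarrow> 'm::finite plan \<Rightarrow> bool" where
  "inter_class_orthogonal k P \<longleftrightarrow>
     (\<exists>\<C>. partition_on (effects_of_interest P) \<C> \<and> card \<C> \<ge> 2 \<and>
        (\<forall>C\<in>\<C>. \<forall>D\<in>\<C>. C \<noteq> D \<longrightarrow>
           (\<forall>E\<in>C. \<forall>G\<in>D. orthogonal_through_blocks k P E G)))"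

text \<open>The linear model with the effects in \<open>S\<close>; \<open>r\<close> picks for each effect the representative
  whose values name its levels, so that \<open>\<theta> E t\<close> is $\theta^a_t$ for \<open>a = r E\<close>.\<close>

definition expected_response ::
    "'m::finite effect set \<Rightarrow> ('m effect \<Rightarrow> 3 ^ 'm) \<Rightarrow>
     real \<Rightarrow> (nat \<Rightarrow> real) \<Rightarrow> ('m effect \<Rightarrow> 3 \<Rightarrow> real) \<Rightarrow> nat \<Rightarrow> 'm run \<Rightarrow> real" where
  "expected_response S r \<mu> \<beta> \<theta> j x = \<mu> + \<beta> j + (\<Sum>E\<in>S. \<theta> E (level (r E) x))"

text \<open>A function of the parameters is estimable if it is the expectation, whatever the parameter
  values, of some linear combination of the responses (\<open>c j i\<close> is the coefficient of run \<open>i\<close> of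
  block \<open>j\<close>).\<close>

definition estimable ::
    "'m::finite plan \<Rightarrow> 'm effect set \<Rightarrow> ('m effect \<Rightarrow> 3 ^ 'm) \<Rightarrow>
     (real \<Rightarrow> (nat \<Rightarrow> real) \<Rightarrow> ('m effect \<Rightarrow> 3 \<Rightarrow> real) \<Rightarrow> real) \<Rightarrow> bool" where
  "estimable P S r \<phi> \<longleftrightarrow>
     (\<exists>c :: nat \<Rightarrow> nat \<Rightarrow> real. \<forall>\<mu> \<beta> \<theta>.
        (\<Sum>j<length P. \<Sum>i<length (P ! j).
           c j i * expected_response S r \<mu> \<beta> \<theta> j (P ! j ! i)) = \<phi> \<mu> \<beta> \<theta>)"

definition estimates :: "'m::finite plan \<Rightarrow> 'm effect set \<Rightarrow> bool" where
  "estimates P S \<longleftrightarrow>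
     (\<forall>r. (\<forall>E\<in>S. r E \<in> E) \<longrightarrow>
        (\<forall>E\<in>S. \<forall>l :: 3 \<Rightarrow> real. (\<Sum>t\<in>UNIV. l t) = 0 \<longrightarrow>
           estimable P S r (\<lambda>\<mu> \<beta> \<theta>. \<Sum>t\<in>UNIV. l t * \<theta> E t)))"

end

theory Submission imports Defs "HOL-Analysis.Analysis" begin

text \<open>Call the factors \<open>A, A', B, B', C, C'\<close> (indices 0 to 5) and let \<open>V\<close> be the plane of all
  \<open>(p, p, q, q, r, r)\<close> with \<open>p + q + r = 0\<close>.  The plan consists of the nine translates by \<open>V\<close> of the
  two blocks \<open>{0, B - A', C - B', A - C'}\<close> and \<open>{0, A', B', C'}\<close>.  For a plan invariant under \<open>V\<close>, two
  effects are orthogonal as soon as their restrictions to \<open>V\<close> are not equal up to sign: then some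
  \<open>w\<close> in \<open>V\<close> changes the level of one of them but not of the other.  The restrictions \<open>0\<close>, \<open>p\<close>, \<open>q\<close>,
  \<open>r\<close> and \<open>p - q\<close> thus give the classes.  Each of the two blocks contributes 3 degrees of freedom for
  each character of \<open>V\<close>, which leaves room for 3 effects restricting to 0 and 6 in each other class;
  27 such effects are chosen so that the linear system of every class is nonsingular.\<close>

subsection \<open>Levels of effects\<close>

lemma three_cases: "(c::3) = 0 \<or> c = 1 \<or> c = -1"
  using exhaust_3[of c] by auto

lemma exhaust_3_zero: "x = 0 \<or> x = 1 \<or> x = 2" for x :: 3
  using exhaust_3[of x] by auto

lemma three_add_self: "x + x = - x" "- x - x = x" "2 * x = - x" for x :: 3
  using three_cases[of x] by auto

lemma scale_two: "2 *s a = - a" for a :: "3 ^ 'm"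
  by (simp add: vec_eq_iff three_add_self)

lemma add_three_numerals:
  "- (1 :: 3) = 2" "- (2 :: 3) = 1" "- (0 :: 3) = 0"
  "x - 0 = x" "0 - x = - x" "0 + x = x" "x + 0 = x"
  "(1 :: 3) + 1 = 2" "(1 :: 3) - 1 = 0" "2 - (2 :: 3) = 0" "(2 :: 3) - 1 = 1"
  "(1 :: 3) + 2 = 0" "(2 :: 3) + 1 = 0" "(2 :: 3) + 2 = 1"
  "(- 1 :: 3) - 1 = 1" "(- 1 :: 3) - 2 = 0" "(1 :: 3) - 2 = 2" for x :: 3
  by simp_all

lemma level_minus_left: "level (- a) x = - level a x"
  by (simp add: level_def sum_negf)

lemma level_add_left: "level (a + b) x = level a x + level b x"
  by (simp add: level_def sum.distrib algebra_simps)

lemma level_add_right: "level a (x + y) = level a x + level a y"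
  by (simp add: level_def sum.distrib algebra_simps)

lemma level_axis: "level (axis i c) x = c * x $ i"
  by (simp add: level_def axis_def if_distrib[where f = "\<lambda>c. c * _"] cong: if_cong)

lemma effect_eq_iff: "effect a = effect b \<longleftrightarrow> b = a \<or> b = - a"
  by (auto simp: effect_def scale_two doubleton_eq_iff)

lemma effect_of_mem: "b \<in> effect a \<Longrightarrow> effect b = effect a"
  by (auto simp: effect_eq_iff) (auto simp: effect_def scale_two)

subsection \<open>Orthogonality in plans invariant under translations\<close>

definition translates :: "'m::finite run list list \<Rightarrow> 'm run list \<Rightarrow> 'm plan" where
  "translates Bs vs = concat (map (\<lambda>B. map (\<lambda>v. map (\<lambda>x. x + v) B) vs) Bs)"

lemma map_mem_translates:
  "B \<in> set Bs \<Longrightarrow> v \<in> set vs \<Longrightarrow> map (\<lambda>x. x + v) B \<in> set (translates Bs vs)"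
  by (auto simp: translates_def)

lemma sum_list_translates:
  "(\<Sum>b\<leftarrow>translates Bs vs. f b) = (\<Sum>B\<leftarrow>Bs. \<Sum>v\<leftarrow>vs. f (map (\<lambda>x. x + v) B))"
  by (induction Bs) (auto simp: translates_def comp_def)

lemma length_filter_conv_sum_list: "length (filter Q xs) = (\<Sum>x\<leftarrow>xs. of_bool (Q x))"
  by (induction xs) auto

lemma length_filter_concat: "length (filter Q (concat xss)) = (\<Sum>xs\<leftarrow>xss. length (filter Q xs))"
  by (induction xss) auto

lemma sum_sum_list_swap:
  "(\<Sum>v\<in>V. \<Sum>x\<leftarrow>B. f x v) = (\<Sum>x\<leftarrow>B. \<Sum>v\<in>V. f x v)" for f :: "'a \<Rightarrow> 'b \<Rightarrow> nat"
  by (induction B) (auto simp: sum.distrib)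

lemma sum_list_times:
  "(\<Sum>x\<leftarrow>xs. f x) * (\<Sum>y\<leftarrow>ys. g y) = (\<Sum>x\<leftarrow>xs. \<Sum>y\<leftarrow>ys. f x * g y)" for f :: "'a \<Rightarrow> nat"
  by (induction xs) (auto simp: sum_list_const_mult algebra_simps)

text \<open>Translation by \<open>w\<close> permutes \<open>vs\<close>, fixes the level of
  \<open>a\<close> and changes that of \<open>b\<close>. Hence the number of shifts on levels
  \<open>(s, t)\<close> of \<open>(a, b)\<close> depends on \<open>s\<close> alone, and both sides
  count the same thing.\<close>

lemma orthogonal_translates:
  fixes vs :: "'m::finite run list"
  assumes len: "\<And>B. B \<in> set Bs \<Longrightarrow> length B = k"
    and vs: "distinct vs" "\<And>u v. u \<in> set vs \<Longrightarrow> v \<in> set vs \<Longrightarrow> u + v \<in> set vs"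
    and w: "w \<in> set vs" "level a w = 0" "level b w \<noteq> 0"
  defines "P \<equiv> translates Bs vs"
  shows "k * N_mat P a b \<alpha> \<beta> = (\<Sum>j<length P. L_mat P a \<alpha> j * L_mat P b \<beta> j)"
proof -
  define c where "c s t = card {v \<in> set vs. level a v = s \<and> level b v = t}" for s t
  have "{v \<in> set vs. level a v = s \<and> level b v = t + level b w} =
      (\<lambda>v. v + w) ` {v \<in> set vs. level a v = s \<and> level b v = t}" for s t
  proof (intro equalityI subsetI)
    fix v assume v: "v \<in> {v \<in> set vs. level a v = s \<and> level b v = t + level b w}"
    \<comment> \<open>In characteristic 3 this is the inverse of \<open>w\<close>, obtained from
      closure under addition alone.\<close>
    define u where "u = w + w"
    have u: "u \<in> set vs" "level a u = 0" "level b u = - level b w" "u + w = 0"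
      using vs(2)[OF w(1) w(1)] level_add_right[of a w w] level_add_right[of b w w] w(2)
        three_add_self(1)[of "level b w"] three_add_self(1) by (simp_all only: u_def) (simp_all add: vec_eq_iff)
    have "v = (v + u) + w" using u(4) by (simp add: add.assoc)
    moreover have "v + u \<in> {v \<in> set vs. level a v = s \<and> level b v = t}"
      using v vs(2) u by (auto simp: level_add_right)
    ultimately show "v \<in> (\<lambda>v. v + w) ` {v \<in> set vs. level a v = s \<and> level b v = t}"
      by blast
  qed (use w vs(2) in \<open>auto simp: level_add_right\<close>)
  then have step: "c s (t + level b w) = c s t" for s t
    unfolding c_def by (simp add: card_image)
  \<comment> \<open>The non-zero element \<open>level b w\<close> generates the field additively, so
    its multiples reach every \<open>t\<close> from 0.\<close>
  have c: "c s t = c s 0" for s t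
    using step[of s 0] step[of s 1] step[of s "-1"] three_cases[of t] w(3) three_cases[of "level b w"]
    by auto
  have count: "(\<Sum>v\<leftarrow>vs. of_bool (level a v = s \<and> level b v = t)) = c s t" for s t
    using vs(1) unfolding c_def by (simp add: sum_list_distinct_conv_sum_set Int_def of_bool_def sum.If_cases)
  have "N_mat P a b \<alpha> \<beta> = (\<Sum>B\<leftarrow>Bs. \<Sum>x\<leftarrow>B. c (\<alpha> - level a x) 0)"
  proof -
    have "(\<Sum>v\<leftarrow>vs. \<Sum>x\<leftarrow>B. of_bool (level a (x + v) = \<alpha> \<and> level b (x + v) = \<beta>)) =
        (\<Sum>x\<leftarrow>B. c (\<alpha> - level a x) 0)" for B
    proof -
      have "(\<Sum>v\<leftarrow>vs. \<Sum>x\<leftarrow>B. of_bool (level a (x + v) = \<alpha> \<and> level b (x + v) = \<beta>)) =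
          (\<Sum>x\<leftarrow>B. \<Sum>v\<leftarrow>vs. of_bool (level a v = \<alpha> - level a x \<and> level b v = \<beta> - level b x) :: nat)"
        using vs(1)
        by (simp add: sum_list_distinct_conv_sum_set sum_sum_list_swap level_add_right eq_diff_eq add.commute)
      then show ?thesis
        unfolding count by (simp add: c[of "\<alpha> - level a x" "\<beta> - level b x" for x])
    qed
    then show ?thesis
      unfolding N_mat_def P_def length_filter_concat sum_list_translates
      by (simp add: length_filter_conv_sum_list comp_def)
  qed
  moreover have "(\<Sum>j<length P. L_mat P a \<alpha> j * L_mat P b \<beta> j) =
      (\<Sum>B\<leftarrow>Bs. length B * (\<Sum>x\<leftarrow>B. c (\<alpha> - level a x) 0))"
  proof -
    have "(\<Sum>v\<leftarrow>vs. (\<Sum>x\<leftarrow>B. of_bool (level a (x + v) = \<alpha>)) * (\<Sum>y\<leftarrow>B. of_bool (level b (y + v) = \<beta>))) =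
        length B * (\<Sum>x\<leftarrow>B. c (\<alpha> - level a x) 0)" for B
    proof -
      have "(\<Sum>v\<leftarrow>vs. (\<Sum>x\<leftarrow>B. of_bool (level a (x + v) = \<alpha>)) * (\<Sum>y\<leftarrow>B. of_bool (level b (y + v) = \<beta>))) =
          (\<Sum>x\<leftarrow>B. \<Sum>y\<leftarrow>B. \<Sum>v\<leftarrow>vs. of_bool (level a v = \<alpha> - level a x \<and> level b v = \<beta> - level b y) :: nat)"
        using vs(1)
        by (simp add: sum_list_distinct_conv_sum_set sum_sum_list_swap sum_list_times level_add_right
            eq_diff_eq add.commute of_bool_conj)
      \<comment> \<open>The count no longer involves \<open>y\<close>, so the sum over
        \<open>y\<close> contributes the factor \<open>length B\<close>.\<close>
      also have "\<dots> = (\<Sum>x\<leftarrow>B. \<Sum>y\<leftarrow>B. c (\<alpha> - level a x) 0)" 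
        unfolding count by (simp add: c[of "\<alpha> - level a x" "\<beta> - level b y" for x y])
      finally show ?thesis by (simp add: sum_list_triv sum_list_const_mult)
    qed
    moreover have "(\<Sum>j<length P. L_mat P a \<alpha> j * L_mat P b \<beta> j) =
        (\<Sum>X\<leftarrow>P. length (filter (\<lambda>x. level a x = \<alpha>) X) * length (filter (\<lambda>x. level b x = \<beta>) X))"
      by (simp add: L_mat_def sum_list_sum_nth atLeast0LessThan)
    ultimately show ?thesis
      unfolding P_def sum_list_translates by (simp add: length_filter_conv_sum_list comp_def)
  qed
  moreover have "(\<Sum>B\<leftarrow>Bs. length B * (\<Sum>x\<leftarrow>B. c (\<alpha> - level a x) 0)) =
      (\<Sum>B\<leftarrow>Bs. k * (\<Sum>x\<leftarrow>B. c (\<alpha> - level a x) 0))"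
    using len by (intro arg_cong[where f = sum_list] map_cong) auto
  ultimately show ?thesis
    by (simp add: sum_list_const_mult)
qed

text \<open>The classes are the fibres of \<open>\<kappa>\<close>; \<open>E0\<close> and
  \<open>G0\<close> witness that there are at least two.\<close>

lemma inter_class_orthogonalI:
  assumes "\<And>E G. E \<in> effects_of_interest P \<Longrightarrow> G \<in> effects_of_interest P \<Longrightarrow> \<kappa> E \<noteq> \<kappa> G \<Longrightarrow>
      orthogonal_through_blocks k P E G"
    and "E0 \<in> effects_of_interest P" "G0 \<in> effects_of_interest P" "\<kappa> E0 \<noteq> \<kappa> G0"
  shows "inter_class_orthogonal k P"
proof -
  define cls where "cls E = {G \<in> effects_of_interest P. \<kappa> G = \<kappa> E}" for E
  have part: "partition_on (effects_of_interest P) (cls ` effects_of_interest P)"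
    by (rule partition_onI) (auto simp: cls_def disjnt_def)
  have "card {cls E0, cls G0} \<le> card (cls ` effects_of_interest P)"
    using assms(2,3) by (intro card_mono) auto
  moreover have "cls E0 \<noteq> cls G0"
    using assms(2,4) by (auto simp: cls_def)
  ultimately have "card (cls ` effects_of_interest P) \<ge> 2"
    by simp
  moreover have "orthogonal_through_blocks k P E G"
    if "C \<in> cls ` effects_of_interest P" "D \<in> cls ` effects_of_interest P" "C \<noteq> D" "E \<in> C" "G \<in> D"
    for C D E G
  proof (rule assms(1))
    show "\<kappa> E \<noteq> \<kappa> G"
      using that by (auto simp: cls_def)
  qed (use that in \<open>auto simp: cls_def\<close>)
  ultimately show ?thesis
    unfolding inter_class_orthogonal_def using part by blast
qed

subsection \<open>A criterion for estimability\<close>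

text \<open>In finite dimension a subspace equals its double orthogonal complement.\<close>

lemma in_span_if_annihilated:
  fixes f :: "'i \<Rightarrow> 'a::euclidean_space"
  assumes "finite I" and "\<And>z. (\<And>i. i \<in> I \<Longrightarrow> f i \<bullet> z = 0) \<Longrightarrow> \<phi> \<bullet> z = 0"
  shows "\<exists>c. \<phi> = (\<Sum>i\<in>I. c i *\<^sub>R f i)"
proof -
  have "\<phi> \<in> (orthogonal_comp (orthogonal_comp (span (f ` I))))"
    using assms(2) by (auto simp: orthogonal_comp_def orthogonal_def span_base inner_commute)
  then have "\<phi> \<in> span (f ` I)"
    using orthogonal_comp_self[of "span (f ` I)"] by simp
  moreover have "\<exists>c. x = (\<Sum>i\<in>I. c i *\<^sub>R f i)" if "x \<in> span (f ` I)" for x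
    using that
  proof (induction rule: span_induct_alt)
    case base
    show ?case by (intro exI[of _ "\<lambda>_. 0"]) simp
  next
    case (step r y x)
    then obtain i c where i: "i \<in> I" "y = f i" and c: "x = (\<Sum>i\<in>I. c i *\<^sub>R f i)"
      by blast
    have "r *\<^sub>R y + x = (\<Sum>j\<in>I. (c j + (if j = i then r else 0)) *\<^sub>R f j)"
      using i assms(1) unfolding c
      by (simp add: scaleR_add_left sum.distrib if_distrib[where f = "\<lambda>r. r *\<^sub>R _"] cong: if_cong)
    then show ?case by (intro exI[of _ "\<lambda>j. c j + (if j = i then r else 0)"])
  qed
  ultimately show ?thesis by blast
qed

text \<open>A linear functional of the parameters that vanishes whenever all within-block differences of
  the expected responses vanish is a linear combination of these differences.\<close>

lemma estimable_if_determined: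
  fixes P :: "'m::finite plan"
  assumes S: "E \<in> S" and l: "(\<Sum>t\<in>UNIV. l t) = 0"
    and det: "\<And>\<theta> :: 'm effect \<Rightarrow> 3 \<Rightarrow> real.
      (\<And>b x y. b \<in> set P \<Longrightarrow> x \<in> set b \<Longrightarrow> y \<in> set b \<Longrightarrow>
        (\<Sum>G\<in>S. \<theta> G (level (r G) x)) = (\<Sum>G\<in>S. \<theta> G (level (r G) y))) \<Longrightarrow>
      \<theta> E 1 = \<theta> E 0 \<and> \<theta> E 2 = \<theta> E 0"
  shows "estimable P S r (\<lambda>\<mu> \<beta> \<theta>. \<Sum>t\<in>UNIV. l t * \<theta> E t)"
proof -
  define I where "I = (SIGMA j:{..<length P}. {..<length (P ! j)})"
  \<comment> \<open>Coefficient vector, in the space of effect parameters, of the difference between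
    run \<open>i\<close> and run 0 of block \<open>j\<close>; \<open>\<phi>\<close> is that of the
    contrast.\<close>
  define f :: "nat \<times> nat \<Rightarrow> real ^ ('m effect \<times> 3)" where
    "f = (\<lambda>(j, i). vec_lambda (\<lambda>(G, t). of_bool (G \<in> S) *
      (of_bool (level (r G) (P ! j ! i) = t) - of_bool (level (r G) (P ! j ! 0) = t))))"
  define \<phi> :: "real ^ ('m effect \<times> 3)" where "\<phi> = vec_lambda (\<lambda>(G, t). of_bool (G = E) * l t)"
  have inner_f: "f (j, i) \<bullet> vec_lambda (case_prod \<theta>) =
      (\<Sum>G\<in>S. \<theta> G (level (r G) (P ! j ! i))) - (\<Sum>G\<in>S. \<theta> G (level (r G) (P ! j ! 0)))"
    for j i and \<theta> :: "'m effect \<Rightarrow> 3 \<Rightarrow> real"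
  proof -
    have "f (j, i) \<bullet> vec_lambda (case_prod \<theta>) = (\<Sum>G\<in>UNIV. \<Sum>t\<in>UNIV. of_bool (G \<in> S) *
        (of_bool (level (r G) (P ! j ! i) = t) - of_bool (level (r G) (P ! j ! 0) = t)) * \<theta> G t)"
      by (simp add: f_def inner_vec_def sum.cartesian_product case_prod_unfold flip: UNIV_Times_UNIV)
    also have "\<dots> = (\<Sum>G\<in>UNIV. of_bool (G \<in> S) *
        (\<theta> G (level (r G) (P ! j ! i)) - \<theta> G (level (r G) (P ! j ! 0))))"
      by (intro sum.cong) (auto simp: left_diff_distrib sum_subtractf)
    also have "\<dots> = (\<Sum>G\<in>S. \<theta> G (level (r G) (P ! j ! i)) - \<theta> G (level (r G) (P ! j ! 0)))"
      by (intro sum.mono_neutral_cong_right) auto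
    finally show ?thesis by (simp add: sum_subtractf)
  qed
  have inner_\<phi>: "\<phi> \<bullet> vec_lambda (case_prod \<theta>) = (\<Sum>t\<in>UNIV. l t * \<theta> E t)" for \<theta> :: "'m effect \<Rightarrow> 3 \<Rightarrow> real"
  proof -
    have "\<phi> \<bullet> vec_lambda (case_prod \<theta>) = (\<Sum>G\<in>UNIV. \<Sum>t\<in>UNIV. of_bool (G = E) * l t * \<theta> G t)"
      by (simp add: \<phi>_def inner_vec_def sum.cartesian_product case_prod_unfold flip: UNIV_Times_UNIV)
    also have "\<dots> = (\<Sum>G\<in>UNIV. of_bool (G = E) * (\<Sum>t\<in>UNIV. l t * \<theta> G t))"
      by (simp add: sum_distrib_left mult.assoc)
    finally show ?thesis by simp
  qed
  have annihilated: "\<phi> \<bullet> z = 0" if z: "\<And>i. i \<in> I \<Longrightarrow> f i \<bullet> z = 0" for z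
  proof -
    define \<theta> where "\<theta> G t = z $ (G, t)" for G t
    have z_eq: "z = vec_lambda (case_prod \<theta>)" by (simp add: \<theta>_def vec_eq_iff)
    have first: "(\<Sum>G\<in>S. \<theta> G (level (r G) (P ! j ! i))) = (\<Sum>G\<in>S. \<theta> G (level (r G) (P ! j ! 0)))"
      if "j < length P" "i < length (P ! j)" for i j
      using z[of "(j, i)"] that unfolding z_eq inner_f by (simp add: I_def)
    have "(\<Sum>G\<in>S. \<theta> G (level (r G) x)) = (\<Sum>G\<in>S. \<theta> G (level (r G) y))"
      if b: "b \<in> set P" and x: "x \<in> set b" and y: "y \<in> set b" for b x y
    proof -
      obtain j where j: "j < length P" "P ! j = b"
        using b by (auto simp: in_set_conv_nth)
      obtain i i' where "i < length b" "b ! i = x" "i' < length b" "b ! i' = y"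
        using x y by (auto simp: in_set_conv_nth)
      then show ?thesis
        using first[of j i] first[of j i'] j by simp
    qed
    then have "\<theta> E 1 = \<theta> E 0 \<and> \<theta> E 2 = \<theta> E 0"
      by (rule det)
    then have "\<theta> E t = \<theta> E 0" for t
      using exhaust_3_zero[of t] by auto
    then have "\<phi> \<bullet> z = (\<Sum>t\<in>UNIV. l t) * \<theta> E 0"
      unfolding z_eq inner_\<phi> sum_distrib_right by (intro sum.cong) auto
    then show ?thesis using l by simp
  qed
  have "finite I" by (simp add: I_def)
  from in_span_if_annihilated[OF this annihilated]
  obtain c where c: "\<phi> = (\<Sum>i\<in>I. c i *\<^sub>R f i)" by blast
  \<comment> \<open>Run 0 is charged with the negated total, so the coefficients in each block sum
    to zero and \<open>\<mu>\<close> and \<open>\<beta> j\<close> cancel.\<close>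
  define c' where "c' j i = c (j, i) - of_bool (i = 0) * (\<Sum>i<length (P ! j). c (j, i))" for j i
  have "(\<Sum>j<length P. \<Sum>i<length (P ! j). c' j i * expected_response S r \<mu> \<beta> \<theta> j (P ! j ! i)) =
      (\<Sum>t\<in>UNIV. l t * \<theta> E t)" for \<mu> \<beta> \<theta>
  proof -
    define X where "X j i = expected_response S r \<mu> \<beta> \<theta> j (P ! j ! i)" for j i
    have "(\<Sum>i<length (P ! j). c' j i * X j i) = (\<Sum>i<length (P ! j). c (j, i) * (X j i - X j 0))" for j
    proof (cases "P ! j = []")
      case False
      then have "(\<Sum>i<length (P ! j). of_bool (i = 0) * (\<Sum>i<length (P ! j). c (j, i)) * X j i) =
          (\<Sum>i<length (P ! j). c (j, i)) * X j 0"
        by (subst sum.mono_neutral_right[of _ "{0}"]) auto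
      then show ?thesis
        by (simp add: c'_def left_diff_distrib right_diff_distrib sum_subtractf sum_distrib_right)
    qed simp
    then have "(\<Sum>j<length P. \<Sum>i<length (P ! j). c' j i * X j i) =
        (\<Sum>(j, i)\<in>I. c (j, i) * (X j i - X j 0))"
      by (simp add: I_def sum.Sigma)
    also have "\<dots> = (\<Sum>(j, i)\<in>I. c (j, i) * (f (j, i) \<bullet> vec_lambda (case_prod \<theta>)))"
      unfolding inner_f by (simp add: X_def expected_response_def)
    also have "\<dots> = \<phi> \<bullet> vec_lambda (case_prod \<theta>)"
      by (simp add: c inner_sum_left case_prod_unfold)
    finally show ?thesis by (simp add: inner_\<phi> X_def)
  qed
  then show ?thesis unfolding estimable_def by blast
qed

text \<open>Reduces an arbitrary choice \<open>r\<close> to the fixed representatives in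
  \<open>A\<close>: where \<open>r\<close> picks \<open>- a\<close>, the parameters are reindexed by
  \<open>t\<close> to \<open>- t\<close>, which preserves constancy.\<close>

lemma estimates_imageI:
  fixes P :: "'m::finite plan"
  assumes inj: "inj_on effect A"
    and det: "\<And>(\<theta> :: 3 ^ 'm \<Rightarrow> 3 \<Rightarrow> real) a.
      (\<And>b x y. b \<in> set P \<Longrightarrow> x \<in> set b \<Longrightarrow> y \<in> set b \<Longrightarrow>
        (\<Sum>a\<in>A. \<theta> a (level a x)) = (\<Sum>a\<in>A. \<theta> a (level a y))) \<Longrightarrow>
      a \<in> A \<Longrightarrow> \<theta> a 1 = \<theta> a 0 \<and> \<theta> a 2 = \<theta> a 0"
  shows "estimates P (effect ` A)"
  unfolding estimates_def
proof (intro allI ballI impI)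
  fix r E and l :: "3 \<Rightarrow> real"
  assume r: "\<forall>E\<in>effect ` A. r E \<in> E" and E: "E \<in> effect ` A" and l: "(\<Sum>t\<in>UNIV. l t) = 0"
  show "estimable P (effect ` A) r (\<lambda>\<mu> \<beta> \<theta>. \<Sum>t\<in>UNIV. l t * \<theta> E t)"
  proof (rule estimable_if_determined[OF E l])
    fix \<theta> :: "'m effect \<Rightarrow> 3 \<Rightarrow> real"
    assume eq: "\<And>b x y. b \<in> set P \<Longrightarrow> x \<in> set b \<Longrightarrow> y \<in> set b \<Longrightarrow>
      (\<Sum>G\<in>effect ` A. \<theta> G (level (r G) x)) = (\<Sum>G\<in>effect ` A. \<theta> G (level (r G) y))"
    define \<theta>' where "\<theta>' a t = \<theta> (effect a) (if r (effect a) = a then t else - t)" for a t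
    have r': "r (effect a) = a \<or> r (effect a) = - a" if "a \<in> A" for a
      using r that by (auto simp: effect_def scale_two)
    have transfer: "(\<Sum>G\<in>effect ` A. \<theta> G (level (r G) x)) = (\<Sum>a\<in>A. \<theta>' a (level a x))" for x
      unfolding sum.reindex[OF inj] comp_def \<theta>'_def
    proof (intro sum.cong refl)
      fix a assume a: "a \<in> A"
      show "\<theta> (effect a) (level (r (effect a)) x) =
          \<theta> (effect a) (if r (effect a) = a then level a x else - level a x)"
      proof (cases "r (effect a) = a")
        case False
        then have "r (effect a) = - a" using r'[OF a] by blast
        then show ?thesis using False by (simp add: level_minus_left)
      qed simp
    qed
    have const: "\<theta>' a 1 = \<theta>' a 0 \<and> \<theta>' a 2 = \<theta>' a 0" if "a \<in> A" for a
    proof (rule det[OF _ that])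
      show "(\<Sum>a\<in>A. \<theta>' a (level a x)) = (\<Sum>a\<in>A. \<theta>' a (level a y))"
        if "b \<in> set P" "x \<in> set b" "y \<in> set b" for b x y
        using that unfolding transfer[symmetric] by (rule eq)
    qed
    obtain a where "a \<in> A" "E = effect a" using E by blast
    then show "\<theta> E 1 = \<theta> E 0 \<and> \<theta> E 2 = \<theta> E 0"
      using const[of a] by (auto simp: \<theta>'_def add_three_numerals split: if_splits)
  qed
qed

subsection \<open>Normalised representatives of the effects\<close>

lemma exhaust_6: "x = 0 \<or> x = 1 \<or> x = 2 \<or> x = 3 \<or> x = 4 \<or> x = 5" for x :: 6
proof (induct x)
  case (of_int z)
  then have "z = 0 \<or> z = 1 \<or> z = 2 \<or> z = 3 \<or> z = 4 \<or> z = 5" by simp arith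
  then show ?case by auto
qed

lemma UNIV_6: "UNIV = {0, 1, 2, 3, 4, 5 :: 6}"
  using exhaust_6 by auto

text \<open>For distinct factors, \<open>c = 1\<close> gives $A_iA_j$ and \<open>c = -1\<close>
  gives $A_iA_j^2$.\<close>

definition pair_vec :: "'m::finite \<Rightarrow> 'm \<Rightarrow> 3 \<Rightarrow> 3 ^ 'm" where
  "pair_vec i j c = axis i 1 + axis j c"

lemma level_pair_vec: "level (pair_vec i j c) x = x $ i + c * x $ j"
  by (simp add: pair_vec_def level_add_left level_axis)

lemma pair_vec_nth: "i \<noteq> j \<Longrightarrow> pair_vec i j c $ k = (if k = i then 1 else if k = j then c else 0)"
  by (auto simp: pair_vec_def axis_def)

lemma weight_axis: "c \<noteq> 0 \<Longrightarrow> weight (axis i c) = 1"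
  by (simp add: weight_def axis_def cong: if_cong)

lemma weight_pair_vec: "i \<noteq> j \<Longrightarrow> c \<noteq> 0 \<Longrightarrow> weight (pair_vec i j c) = 2"
proof -
  assume "i \<noteq> j" "c \<noteq> 0"
  then have "{k. pair_vec i j c $ k \<noteq> 0} = {i, j}" by (auto simp: pair_vec_nth)
  then show ?thesis using \<open>i \<noteq> j\<close> by (simp add: weight_def)
qed

definition pairs :: "('m::{finite,linorder} \<times> 'm \<times> 3) set" where
  "pairs = {(i, j, c). i < j \<and> c \<noteq> 0}"

lemma main_effects_eq: "main_effects = effect ` range (\<lambda>i::'m::finite. axis i 1)"
proof -
  have "\<exists>i. effect a = effect (axis i 1)" if w: "weight a = 1" for a :: "3 ^ 'm"
  proof -
    obtain i where i: "{k. a $ k \<noteq> 0} = {i}"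
      using w by (metis card_1_singletonE weight_def)
    then have "a $ i \<noteq> 0" "\<And>k. k \<noteq> i \<Longrightarrow> a $ k = 0" by auto
    then have "a = axis i 1 \<or> axis i 1 = - a"
      using three_cases[of "a $ i"] by (auto simp: vec_eq_iff axis_def)
    then show ?thesis unfolding effect_eq_iff by blast
  qed
  moreover have "weight (axis i 1 :: 3 ^ 'm) = 1" for i :: 'm
    by (rule weight_axis) simp
  ultimately show ?thesis
    unfolding main_effects_def by blast
qed

lemma two_factor_interactions_eq:
  "two_factor_interactions = effect ` (\<lambda>(i, j, c). pair_vec i j c) ` (pairs :: ('m::{finite,linorder} \<times> 'm \<times> 3) set)"
proof -
  have "\<exists>t\<in>pairs. effect a = effect ((\<lambda>(i, j, c). pair_vec i j c) t)"
    if w: "weight a = 2" for a :: "(3, 'm) vec"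
  proof -
    obtain i' j' where ij': "{k. a $ k \<noteq> 0} = {i', j'}" "i' \<noteq> j'"
      using w by (auto simp: weight_def card_2_iff)
    obtain i j where "{k. a $ k \<noteq> 0} = {i, j}" "i < j"
    proof (cases "i' < j'")
      case True
      then show thesis using ij' that by blast
    next
      case False
      then have "{k. a $ k \<noteq> 0} = {j', i'}" "j' < i'"
        using ij' by auto
      then show thesis using that by blast
    qed
    then have ij: "a $ i \<noteq> 0" "a $ j \<noteq> 0" "\<And>k. k \<noteq> i \<Longrightarrow> k \<noteq> j \<Longrightarrow> a $ k = 0" "i < j" by auto
    have "pair_vec i j (a $ j) = a \<or> pair_vec i j (- (a $ j)) = - a"
      using three_cases[of "a $ i"] ij by (auto simp: vec_eq_iff pair_vec_nth)
    then have "effect a = effect (pair_vec i j (a $ j)) \<or> effect a = effect (pair_vec i j (- (a $ j)))"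
      unfolding effect_eq_iff by blast
    moreover have "(i, j, a $ j) \<in> pairs" "(i, j, - (a $ j)) \<in> pairs"
      using ij by (auto simp: pairs_def)
    ultimately show ?thesis by force
  qed
  then show ?thesis
    by (auto simp: two_factor_interactions_def pairs_def weight_pair_vec image_iff)
qed

text \<open>The representatives in use are normalised: their first non-zero entry is 1.\<close>

lemma inj_on_effect:
  "inj_on effect (range (\<lambda>i. axis i 1) \<union> (\<lambda>(i, j, c). pair_vec i j c) ` (pairs :: ('m::{finite,linorder} \<times> 'm \<times> 3) set))"
proof (rule inj_onI)
  let ?A = "range (\<lambda>i. axis i 1) \<union> (\<lambda>(i, j, c). pair_vec i j c) ` (pairs :: ('m \<times> 'm \<times> 3) set)"
  have normal: "\<exists>i. a $ i = 1 \<and> (\<forall>j<i. a $ j = 0)" if "a \<in> ?A" for a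
    using that
  proof
    assume "a \<in> range (\<lambda>i. axis i 1)"
    then show ?thesis by (force simp: axis_def)
  next
    assume "a \<in> (\<lambda>(i, j, c). pair_vec i j c) ` pairs"
    then obtain i j c where "a = pair_vec i j c" "i < j" by (auto simp: pairs_def)
    then show ?thesis by (intro exI[of _ i]) (auto simp: pair_vec_nth)
  qed
  fix a b assume "a \<in> ?A" "b \<in> ?A" "effect a = effect b"
  moreover have "b \<noteq> - a"
  proof
    assume b: "b = - a"
    \<comment> \<open>\<open>i\<close> and \<open>j\<close> are the first non-zero positions of
      \<open>a\<close> and of \<open>- a\<close>. They must coincide, but then the entry there is
      both 1 and -1.\<close>
    obtain i j where "a $ i = 1" "\<forall>k<i. a $ k = 0" "a $ j = - 1" "\<forall>k<j. a $ k = 0"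
      using normal[OF \<open>a \<in> ?A\<close>] normal[OF \<open>b \<in> ?A\<close>] unfolding b
      by (auto simp: minus_equation_iff[of _ "1::3"] eq_commute[of "-1::3"])
    then show False by (cases i j rule: linorder_cases) auto
  qed
  ultimately show "a = b" by (auto simp: effect_eq_iff)
qed

lemma inj_on_pair_vec:
  "inj_on (\<lambda>(i, j, c). pair_vec i j c) (pairs :: ('m::{finite,linorder} \<times> 'm \<times> 3) set)"
proof (rule inj_onI)
  have supp: "{k. pair_vec i j c $ k \<noteq> 0} = {i, j}" if "(i, j, c) \<in> pairs" for i j :: 'm and c
    using that by (auto simp: pairs_def pair_vec_nth split: if_splits)
  fix s t :: "'m \<times> 'm \<times> 3"
  assume st: "s \<in> pairs" "t \<in> pairs" "(\<lambda>(i, j, c). pair_vec i j c) s = (\<lambda>(i, j, c). pair_vec i j c) t"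
  obtain i j c i' j' c' where s: "s = (i, j, c)" and t: "t = (i', j', c')"
    by (cases s, cases t)
  have m: "(i, j, c) \<in> pairs" "(i', j', c') \<in> pairs" and eq: "pair_vec i j c = pair_vec i' j' c'"
    using st by (simp_all add: s t)
  then have "{i, j} = {i', j'}"
    using supp[OF m(1)] supp[OF m(2)] by simp
  then have ij: "i = i'" "j = j'"
    using m by (auto simp: pairs_def doubleton_eq_iff)
  then show "s = t"
    unfolding s t using m arg_cong[OF eq, of "\<lambda>a. a $ j"] by (auto simp: pairs_def pair_vec_nth split: if_splits)
qed

subsection \<open>The plan\<close>

text \<open>Coordinates \<open>p\<close>, \<open>q\<close> on the plane \<open>V\<close>, with
  \<open>r = - p - q\<close>.\<close>

definition shift :: "3 \<Rightarrow> 3 \<Rightarrow> 6 run" where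
  "shift p q = (\<chi> i. if i \<in> {0, 1} then p else if i \<in> {2, 3} then q else - p - q)"

definition shifts :: "6 run list" where
  "shifts = [shift p q. p \<leftarrow> [0, 1, 2], q \<leftarrow> [0, 1, 2]]"

text \<open>The rotation \<open>A, B, C\<close> to \<open>B, C, A\<close>, applied to the primed
  factors as well, preserves both blocks and \<open>V\<close> and permutes \<open>p\<close>,
  \<open>q\<close>, \<open>r\<close>.\<close>

definition base_blocks :: "6 run list list" where
  "base_blocks =
    [[0, axis 2 1 - axis 1 1, axis 4 1 - axis 3 1, axis 0 1 - axis 5 1],
     [0, axis 1 1, axis 3 1, axis 5 1]]"

definition the_plan :: "6 plan" where
  "the_plan = translates base_blocks shifts"

text \<open>The two-factor interactions to be estimated, one line for each of the restrictions \<open>0\<close>, \<open>p\<close>, \<open>q\<close>,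
  \<open>r\<close>, \<open>p - q\<close> to \<open>V\<close> (up to sign).\<close>

definition kept :: "(6 \<times> 6 \<times> 3) set" where
  "kept = {(0, 1, -1), (2, 3, -1), (4, 5, -1),
    (2, 4, 1), (2, 5, 1), (3, 4, 1), (3, 5, 1),
    (0, 4, 1), (1, 4, 1), (0, 5, 1), (1, 5, 1),
    (0, 2, 1), (0, 3, 1), (1, 2, 1), (1, 3, 1),
    (0, 3, -1), (2, 5, -1), (1, 4, -1), (1, 3, -1), (3, 5, -1), (1, 5, -1)}"

lemma less_6_iff:
  "i < j \<longleftrightarrow> (i, j) \<in> {(0, 1), (0, 2), (0, 3), (0, 4), (0, 5), (1, 2), (1, 3), (1, 4), (1, 5),
    (2, 3), (2, 4), (2, 5), (3, 4), (3, 5), (4, 5)}" for i j :: 6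
  using exhaust_6[of i] exhaust_6[of j]
  by (elim disjE; simp add: less_bit0_def bit0.Rep_numeral bit0.Rep_0 bit0.Rep_1)

text \<open>The nine further triples are the interactions given up. With them the classes of
  \<open>p\<close>, \<open>q\<close>, \<open>r\<close> would have 7 effects each
  (\<open>A + A'\<close> restricts to \<open>- p\<close>) and that of \<open>p - q\<close> would
  have 12, against room for 6.\<close>

lemma pairs_6:
  "pairs = kept \<union> {(0, 1, 1), (2, 3, 1), (4, 5, 1), (0, 2, -1), (2, 4, -1), (0, 4, -1),
    (1, 2, -1), (3, 4, -1), (0, 5, -1)}" (is "_ = ?K")
proof (intro equalityI subsetI)
  fix t :: "6 \<times> 6 \<times> 3" assume "t \<in> pairs"
  then obtain i j c where t: "t = (i, j, c)" and "(i :: 6) < j" and c: "(c::3) = 1 \<or> c = -1"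
    using three_cases by (fastforce simp: pairs_def)
  from this(2) have "(i, j) \<in> {(0, 1), (0, 2), (0, 3), (0, 4), (0, 5), (1, 2), (1, 3), (1, 4), (1, 5),
      (2, 3), (2, 4), (2, 5), (3, 4), (3, 5), (4, 5)}"
    by (simp only: less_6_iff)
  with c show "t \<in> ?K"
    unfolding insert_iff t kept_def by (elim disjE emptyE; simp)
next
  fix t :: "6 \<times> 6 \<times> 3" assume "t \<in> ?K"
  then show "t \<in> pairs"
    unfolding kept_def Un_insert_left insert_iff Un_empty_left
    by (elim disjE emptyE; hypsubst; simp add: pairs_def less_6_iff)
qed

section \<open>Levels on the plane \<open>V\<close> and orthogonality between the classes\<close>

lemma level_scale_right: "level a (c *s x) = c * level a x"
  by (simp add: level_def sum_distrib_left mult.left_commute)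

lemma shift_add: "shift p q + shift p' q' = shift (p + p') (q + q')"
  by (simp add: shift_def vec_eq_iff)

lemma shift_eq_iff: "shift p q = shift p' q' \<longleftrightarrow> p = p' \<and> q = q'"
proof
  assume "shift p q = shift p' q'"
  then have "shift p q $ 0 = shift p' q' $ 0" "shift p q $ 2 = shift p' q' $ 2" by simp_all
  then show "p = p' \<and> q = q'" by (simp add: shift_def)
qed simp

lemma level_shift: "level a (shift p q) = p * level a (shift 1 0) + q * level a (shift 0 1)"
proof -
  have "shift p q = p *s shift 1 0 + q *s shift 0 1"
    by (simp add: shift_def vec_eq_iff)
  then show ?thesis by (simp only: level_add_right level_scale_right)
qed

lemma shift_mem: "shift p q \<in> set shifts"
  using exhaust_3_zero[of p] exhaust_3_zero[of q] by (auto simp: shifts_def)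

lemma shifts_closed: "u \<in> set shifts \<Longrightarrow> v \<in> set shifts \<Longrightarrow> u + v \<in> set shifts"
proof -
  assume "u \<in> set shifts" "v \<in> set shifts"
  then obtain p q p' q' where "u = shift p q" "v = shift p' q'" unfolding shifts_def by auto
  then show ?thesis by (simp add: shift_add shift_mem)
qed

lemma distinct_shifts: "distinct shifts"
  by (simp add: shifts_def shift_eq_iff)

text \<open>Linear forms on the plane that differ by more than a sign have different kernels. Two
  alternatives are needed because one form may vanish identically, its kernel then containing the
  other.\<close>

lemma separating_direction:
  fixes a1 a2 b1 b2 :: 3
  assumes "(b1, b2) \<noteq> (a1, a2)" "(b1, b2) \<noteq> (- a1, - a2)"
  obtains p q where "p * a1 + q * a2 = 0" "p * b1 + q * b2 \<noteq> 0"
    | p q where "p * a1 + q * a2 \<noteq> 0" "p * b1 + q * b2 = 0"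
proof -
  have ex_3: "(\<exists>i::3. P i) \<longleftrightarrow> P 1 \<or> P 2 \<or> P 3" for P
    by (metis exhaust_3)
  have "(\<exists>p q. p * a1 + q * a2 = 0 \<and> p * b1 + q * b2 \<noteq> 0) \<or>
      (\<exists>p q. p * a1 + q * a2 \<noteq> 0 \<and> p * b1 + q * b2 = 0)"
    using assms exhaust_3[of a1] exhaust_3[of a2] exhaust_3[of b1] exhaust_3[of b2]
    by (elim disjE; simp add: ex_3)
  then show ?thesis using that by blast
qed

text \<open>The coefficients in \<open>p\<close> and \<open>q\<close> of the level on
  \<open>V\<close>; taking the image of both representatives makes this a pair up to sign.\<close>

definition restriction :: "6 effect \<Rightarrow> (3 \<times> 3) set" where
  "restriction E = (\<lambda>a. (level a (shift 1 0), level a (shift 0 1))) ` E"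

lemma orthogonal_the_plan:
  assumes "E \<in> range effect" "G \<in> range effect" "restriction E \<noteq> restriction G"
  shows "orthogonal_through_blocks 4 the_plan E G"
  unfolding orthogonal_through_blocks_def
proof (intro ballI allI)
  fix a b \<alpha> \<beta> assume "a \<in> E" "b \<in> G"
  then have EG: "E = effect a" "G = effect b"
    using assms(1,2) effect_of_mem by auto
  let ?a1 = "level a (shift 1 0)" and ?a2 = "level a (shift 0 1)"
  let ?b1 = "level b (shift 1 0)" and ?b2 = "level b (shift 0 1)"
  have "(?b1, ?b2) \<noteq> (?a1, ?a2)" "(?b1, ?b2) \<noteq> (- ?a1, - ?a2)"
    using assms(3) unfolding EG by (auto simp: restriction_def effect_def scale_two level_minus_left)
  then have "4 * N_mat (translates base_blocks shifts) a b \<alpha> \<beta> =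
      (\<Sum>j<length (translates base_blocks shifts). L_mat (translates base_blocks shifts) a \<alpha> j *
        L_mat (translates base_blocks shifts) b \<beta> j)"
  proof (cases rule: separating_direction)
    case (1 p q)
    show ?thesis
      using 1 by (intro orthogonal_translates[where w = "shift p q"] shifts_closed distinct_shifts shift_mem)
        (auto simp: base_blocks_def level_shift[of _ p q])
  next
    case (2 p q)
    \<comment> \<open>Here the shift fixes the level of \<open>b\<close> and moves that of
      \<open>a\<close>; the condition is symmetric in the two effects.\<close>
    have "4 * N_mat (translates base_blocks shifts) b a \<beta> \<alpha> =
      (\<Sum>j<length (translates base_blocks shifts). L_mat (translates base_blocks shifts) b \<beta> j *
        L_mat (translates base_blocks shifts) a \<alpha> j)"
      using 2 by (intro orthogonal_translates[where w = "shift p q"] shifts_closed distinct_shifts shift_mem)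
        (auto simp: base_blocks_def level_shift[of _ p q])
    then show ?thesis
      by (simp add: N_mat_def mult.commute conj_commute)
  qed
  then show "4 * N_mat the_plan a b \<alpha> \<beta> =
      (\<Sum>j<length the_plan. L_mat the_plan a \<alpha> j * L_mat the_plan b \<beta> j)"
    by (simp add: the_plan_def)
qed

lemma inter_class_orthogonal_the_plan: "inter_class_orthogonal 4 the_plan"
proof (rule inter_class_orthogonalI[where \<kappa> = restriction])
  show "orthogonal_through_blocks 4 the_plan E G"
    if "E \<in> effects_of_interest the_plan" "G \<in> effects_of_interest the_plan"
      "restriction E \<noteq> restriction G" for E G
    using that by (intro orthogonal_the_plan)
      (auto simp: effects_of_interest_def main_effects_def two_factor_interactions_def)
  have block: "map (\<lambda>x. x + shift 0 0) (base_blocks ! 0) \<in> set the_plan"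
    unfolding the_plan_def by (intro map_mem_translates shift_mem) (simp add: base_blocks_def)
  have "\<not> confounded the_plan (effect (axis i 1))" if "i = 0 \<or> i = 2" for i
  proof -
    \<comment> \<open>The runs \<open>A - C'\<close> and \<open>B - A'\<close> of the first base
      block show, against run 0, that \<open>A\<close> and \<open>B\<close> are not
      confounded.\<close>
    have "level (axis i 1) (0 + shift 0 0) \<noteq> level (axis i 1) (axis i 1 - axis (if i = 0 then 5 else 1) 1 + shift 0 0)"
      using that unfolding level_add_right level_axis by (auto simp: axis_def)
    moreover have "axis i 1 - axis (if i = 0 then 5 else 1) 1 + shift 0 0 \<in> set (map (\<lambda>x. x + shift 0 0) (base_blocks ! 0))"
      "0 + shift 0 0 \<in> set (map (\<lambda>x. x + shift 0 0) (base_blocks ! 0))"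
      using that by (auto simp: base_blocks_def)
    ultimately show ?thesis
      using block unfolding confounded_def effect_def by blast
  qed
  moreover have "effect (axis i 1) \<in> main_effects" for i :: 6
    by (auto simp: main_effects_eq)
  ultimately show "effect (axis 0 1) \<in> effects_of_interest the_plan"
    "effect (axis 2 1) \<in> effects_of_interest the_plan"
    by (auto simp: effects_of_interest_def)
  show "restriction (effect (axis 0 1)) \<noteq> restriction (effect (axis 2 1))"
    by (auto simp: restriction_def effect_def level_axis shift_def scale_two level_minus_left doubleton_eq_iff)
qed

subsection \<open>Estimability of the effects in each class\<close>

text \<open>The class of \<open>p\<close>: the functions belong to the effects \<open>A\<close>, \<open>A'\<close>, \<open>B + C\<close>, \<open>B + C'\<close>, \<open>B' + C\<close>,
  \<open>B' + C'\<close>, the equations compare the runs \<open>B - A'\<close>, \<open>C - B'\<close>, \<open>A - C'\<close>, \<open>A'\<close>, \<open>B'\<close>, \<open>C'\<close> with the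
  run \<open>0\<close>, and \<open>s\<close> is the value of \<open>p\<close> on the translation.  By cyclic symmetry this also covers the
  classes of \<open>q\<close> and \<open>r\<close>.\<close>

lemma main_class_determined:
  fixes f1 f2 f3 f4 f5 f6 :: "3 \<Rightarrow> real"
  assumes "\<And>s. f1 s + f2 (s-1) + f3 (1-s) + f4 (1-s) + f5 (-s) + f6 (-s) = f1 s + f2 s + f3 (-s) + f4 (-s) + f5 (-s) + f6 (-s)"
    "\<And>s. f1 s + f2 s + f3 (1-s) + f4 (-s) + f5 (-s) + f6 (-1-s) = f1 s + f2 s + f3 (-s) + f4 (-s) + f5 (-s) + f6 (-s)"
    "\<And>s. f1 (s+1) + f2 s + f3 (-s) + f4 (-1-s) + f5 (-s) + f6 (-1-s) = f1 s + f2 s + f3 (-s) + f4 (-s) + f5 (-s) + f6 (-s)"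
    "\<And>s. f1 s + f2 (s+1) + f3 (-s) + f4 (-s) + f5 (-s) + f6 (-s) = f1 s + f2 s + f3 (-s) + f4 (-s) + f5 (-s) + f6 (-s)"
    "\<And>s. f1 s + f2 s + f3 (-s) + f4 (-s) + f5 (1-s) + f6 (1-s) = f1 s + f2 s + f3 (-s) + f4 (-s) + f5 (-s) + f6 (-s)"
    "\<And>s. f1 s + f2 s + f3 (-s) + f4 (1-s) + f5 (-s) + f6 (1-s) = f1 s + f2 s + f3 (-s) + f4 (-s) + f5 (-s) + f6 (-s)"
  shows "\<forall>f\<in>{f1,f2,f3,f4,f5,f6}. f 1 = f 0 \<and> f 2 = f 0"
proof -
  \<comment> \<open>Summed over \<open>s\<close>, each equation becomes an identity, so two values
    of \<open>s\<close> carry its full content.\<close>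
  note e = assms(1)[of 0] assms(1)[of 1] assms(2)[of 0] assms(2)[of 1] assms(3)[of 0] assms(3)[of 1] 
    assms(4)[of 0] assms(4)[of 1]  assms(5)[of 0] assms(5)[of 1]  assms(6)[of 0] assms(6)[of 1] 
  note e = e[unfolded add_three_numerals]
  have 2: "f2 1 = f2 0" "f2 2 = f2 0" using e(7,8) by linarith+
  have 5: "f5 1 = f5 0 + f6 0 - f6 1" "f5 2 = f5 0 + f6 0 - f6 2" using e(9,10) by linarith+
  have 4: "f4 1 = f4 0 + f6 0 - f6 1" "f4 2 = f4 0 + f6 0 - f6 2" using e(11,12) by linarith+
  have 3: "f3 1 = f3 0 - f6 0 + f6 1" "f3 2 = f3 0 - f6 0 + f6 2" using e(1,2) 2 4 by linarith+
  \<comment> \<open>As \<open>f3 - f6\<close> is constant, the second equation makes each value of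
    \<open>f6\<close> the mean of all three.\<close>
  have 6: "f6 1 = f6 0" "f6 2 = f6 0" using e(3,4) 3 by linarith+
  have 1: "f1 1 = f1 0" "f1 2 = f1 0" using e(5,6) 4 6 by linarith+
  show ?thesis using 1 2 3 4 5 6 by simp
qed

text \<open>The class of \<open>p - q\<close>, with the same runs and the effects \<open>A - B'\<close>, \<open>B - C'\<close>, \<open>C - A'\<close>, \<open>A' - B'\<close>,
  \<open>B' - C'\<close>, \<open>C' - A'\<close>.\<close>

lemma difference_class_determined:
  fixes f1 f2 f3 f4 f5 f6 :: "3 \<Rightarrow> real"
  assumes 
   "\<And>s. f1 s + f2 (s+1) + f3 (s+1) + f4 (s-1) + f5 s + f6 (s+1) = f1 s + f2 s + f3 s + f4 s + f5 s + f6 s"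
   "\<And>s. f1 (s+1) + f2 s + f3 (s+1) + f4 (s+1) + f5 (s-1) + f6 s = f1 s + f2 s + f3 s + f4 s + f5 s + f6 s"
   "\<And>s. f1 (s+1) + f2 (s+1) + f3 s + f4 s + f5 (s+1) + f6 (s-1) = f1 s + f2 s + f3 s + f4 s + f5 s + f6 s"
   "\<And>s. f1 s + f2 s + f3 (s-1) + f4 (s+1) + f5 s + f6 (s-1) = f1 s + f2 s + f3 s + f4 s + f5 s + f6 s"
   "\<And>s. f1 (s-1) + f2 s + f3 s + f4 (s-1) + f5 (s+1) + f6 s = f1 s + f2 s + f3 s + f4 s + f5 s + f6 s"
   "\<And>s. f1 s + f2 (s-1) + f3 s + f4 s + f5 (s-1) + f6 (s+1) = f1 s + f2 s + f3 s + f4 s + f5 s + f6 s"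
  shows "\<forall>f\<in>{f1,f2,f3,f4,f5,f6}. f 1 = f 0 \<and> f 2 = f 0"
proof -
  note e = assms[of 0] assms[of 1] assms[of 2]
  note e = e[unfolded add_three_numerals]
  note E1 = e(1,7,13) and E2 = e(2,8,14) and E3 = e(3,9,15)
    and E4 = e(4,10,16) and E5 = e(5,11,17) and E6 = e(6,12,18)
  define D where "D f s = f (s + 1) - f s" for f :: "3 \<Rightarrow> real" and s
  have Z: "D f 2 = - D f 0 - D f 1" for f unfolding D_def add_three_numerals by simp
  note d = D_def[of _ 0, unfolded add_three_numerals] D_def[of _ 1, unfolded add_three_numerals]
  \<comment> \<open>Combining the equations of \<open>B - A'\<close> and \<open>A'\<close>
    eliminates \<open>f3\<close> and \<open>f6\<close>; rotation gives the analogous formulas for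
    \<open>f3\<close> and \<open>f1\<close>.\<close>
  have 2: "D f2 0 = D f4 2 - D f4 1" "D f2 1 = D f4 0 - D f4 2"
    using E1 E4 unfolding Z d by linarith+
  have 3: "D f3 0 = D f5 2 - D f5 1" "D f3 1 = D f5 0 - D f5 2"
    using E2 E5 unfolding Z d by linarith+
  have 1: "D f1 0 = D f6 2 - D f6 1" "D f1 1 = D f6 0 - D f6 2"
    using E3 E6 unfolding Z d by linarith+
  \<comment> \<open>Substituting these formulas leaves a cyclic system in the differences of
    \<open>f4\<close>, \<open>f5\<close>, \<open>f6\<close> alone.\<close>
  have "D f3 0 + D f6 0 = D f4 1" "D f3 1 + D f6 1 = D f4 2"
    using E4 unfolding Z d by linarith+
  note B1 = this[unfolded 3]
  have "D f1 0 + D f4 0 = D f5 1" "D f1 1 + D f4 1 = D f5 2"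
    using E5 unfolding Z d by linarith+
  note B2 = this[unfolded 1]
  have "D f2 0 + D f5 0 = D f6 1" "D f2 1 + D f5 1 = D f6 2"
    using E6 unfolding Z d by linarith+
  note B3 = this[unfolded 2]
  have 5: "D f5 0 = 2 * D f6 2 - D f6 1" "D f5 1 = 2 * D f6 0 - D f6 2"
    using B1 B2 Z[of f4] Z[of f5] Z[of f6] by linarith+
  have 6: "D f6 0 = 0" "D f6 1 = 0"
    using B2 B3 5 Z[of f4] Z[of f5] Z[of f6] by linarith+
  have 5: "D f5 0 = 0" "D f5 1 = 0" using 5 6 Z[of f6] by linarith+
  have 4: "D f4 0 = 0" "D f4 1 = 0" using B2 5 6 Z[of f5] Z[of f6] by linarith+
  have "D f 0 = 0 \<and> D f 1 = 0 \<Longrightarrow> f 1 = f 0 \<and> f 2 = f 0" for f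
    unfolding d by linarith
  moreover have "\<forall>f\<in>{f1,f2,f3,f4,f5,f6}. D f 0 = 0 \<and> D f 1 = 0"
    using 1 2 3 4 5 6 by (simp add: Z)
  ultimately show ?thesis by blast
qed

section \<open>Separating the classes by summation along lines\<close>

lemma sum_UNIV_shift:
  fixes f :: "3 \<Rightarrow> real"
  shows "(\<Sum>s\<in>UNIV. f (c + s)) = (\<Sum>s\<in>UNIV. f s)" "(\<Sum>s\<in>UNIV. f (s + c)) = (\<Sum>s\<in>UNIV. f s)"
    "(\<Sum>s\<in>UNIV. f (c - s)) = (\<Sum>s\<in>UNIV. f s)" "(\<Sum>s\<in>UNIV. f (- s)) = (\<Sum>s\<in>UNIV. f s)"
proof -
  show "(\<Sum>s\<in>UNIV. f (c + s)) = (\<Sum>s\<in>UNIV. f s)"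
    by (rule sum.reindex_bij_witness[of _ "\<lambda>s. s - c" "\<lambda>s. c + s"]) auto
  then show "(\<Sum>s\<in>UNIV. f (s + c)) = (\<Sum>s\<in>UNIV. f s)"
    by (simp only: add.commute)
  show "(\<Sum>s\<in>UNIV. f (c - s)) = (\<Sum>s\<in>UNIV. f s)"
    by (rule sum.reindex_bij_witness[of _ "\<lambda>s. c - s" "\<lambda>s. c - s"]) auto
  show "(\<Sum>s\<in>UNIV. f (- s)) = (\<Sum>s\<in>UNIV. f s)"
    by (rule sum.reindex_bij_witness[of _ uminus uminus]) auto
qed

text \<open>Summing over the three parallels of a line in the \<open>(p, q)\<close>-plane isolates the terms that are
  constant on that line.\<close>

lemma separate_directions:
  fixes ha hb hc hd :: "3 \<Rightarrow> real"
  assumes eq: "\<And>p q. hz + ha p + hb q + hc (- p - q) + hd (p - q) = gz + ga p + gb q + gc (- p - q) + gd (p - q)"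
    and sums: "(\<Sum>s\<in>UNIV. ha s) = (\<Sum>s\<in>UNIV. ga s)" "(\<Sum>s\<in>UNIV. hb s) = (\<Sum>s\<in>UNIV. gb s)"
      "(\<Sum>s\<in>UNIV. hc s) = (\<Sum>s\<in>UNIV. gc s)" "(\<Sum>s\<in>UNIV. hd s) = (\<Sum>s\<in>UNIV. gd s)"
  shows "hz = gz" "ha s = ga s" "hb s = gb s" "hc s = gc s" "hd s = gd s"
proof -
  have 1: "hz + ha s = gz + ga s" for s
  proof -
    have "(\<Sum>q\<in>UNIV. hz + ha s + hb q + hc (- s - q) + hd (s - q)) =
        (\<Sum>q\<in>UNIV. gz + ga s + gb q + gc (- s - q) + gd (s - q))"
      using eq by (intro sum.cong) auto
    then show ?thesis using sums by (simp add: sum.distrib sum_UNIV_shift)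
  qed
  have 2: "hz + hb s = gz + gb s" for s
  proof -
    \<comment> \<open>Writing \<open>p + (- s)\<close> for \<open>p - s\<close> lets the rule for a
      sum over \<open>s + c\<close> apply.\<close>
    have "(\<Sum>p\<in>UNIV. hz + ha p + hb s + hc (- s - p) + hd (p + (- s))) =
        (\<Sum>p\<in>UNIV. gz + ga p + gb s + gc (- s - p) + gd (p + (- s)))"
    proof (intro sum.cong refl)
      fix p
      have "- s - p = - p - s" "p + (- s) = p - s" by simp_all
      then show "hz + ha p + hb s + hc (- s - p) + hd (p + (- s)) = gz + ga p + gb s + gc (- s - p) + gd (p + (- s))"
        using eq[of p s] by (simp only:)
    qed
    then show ?thesis using sums by (simp only: sum.distrib sum_UNIV_shift) simp
  qed
  have 3: "hz + hc s = gz + gc s" for s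
  proof -
    have "(\<Sum>p\<in>UNIV. hz + ha p + hb (- s - p) + hc s + hd (s - p)) =
        (\<Sum>p\<in>UNIV. gz + ga p + gb (- s - p) + gc s + gd (s - p))"
    proof (intro sum.cong refl)
      fix p
      have "- p - (- s - p) = s" "p - (- s - p) = s - p"
        using three_add_self[of p] by (simp_all add: algebra_simps)
      then show "hz + ha p + hb (- s - p) + hc s + hd (s - p) = gz + ga p + gb (- s - p) + gc s + gd (s - p)"
        using eq[of p "- s - p"] by (simp only:)
    qed
    then show ?thesis using sums by (simp add: sum.distrib sum_UNIV_shift)
  qed
  have 4: "hz + hd s = gz + gd s" for s
  proof -
    have "(\<Sum>p\<in>UNIV. hz + ha p + hb (p + (- s)) + hc (s + p) + hd s) =
        (\<Sum>p\<in>UNIV. gz + ga p + gb (p + (- s)) + gc (s + p) + gd s)"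
    proof (intro sum.cong refl)
      fix p
      have "- p - (p + (- s)) = s + p" "p - (p + (- s)) = s"
        using three_add_self[of p] by (simp_all add: algebra_simps)
      then show "hz + ha p + hb (p + (- s)) + hc (s + p) + hd s = gz + ga p + gb (p + (- s)) + gc (s + p) + gd s"
        using eq[of p "p + (- s)"] by (simp only:)
    qed
    then show ?thesis using sums by (simp only: sum.distrib sum_UNIV_shift) simp
  qed
  \<comment> \<open>The constant is still merged with each function; one more sum over
    \<open>s\<close> removes the functions and isolates it.\<close>
  have "(\<Sum>s\<in>UNIV. hz + ha s) = (\<Sum>s\<in>UNIV. gz + ga s)"
    using 1 by (intro sum.cong) auto
  then show 0: "hz = gz" using sums by (simp add: sum.distrib)
  show "ha s = ga s" "hb s = gb s" "hc s = gc s" "hd s = gd s"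
    using 0 1[of s] 2[of s] 3[of s] 4[of s] by simp_all
qed

section \<open>The estimated effects and the proof that the plan determines them\<close>

definition estimated_vecs :: "(3 ^ 6) set" where
  "estimated_vecs = range (\<lambda>i. axis i 1) \<union> (\<lambda>(i, j, c). pair_vec i j c) ` kept"

lemma kept_subset: "kept \<subseteq> pairs"
  unfolding pairs_6 by (rule Un_upper1)

lemma estimated_vecs_subset:
  "estimated_vecs \<subseteq> range (\<lambda>i. axis i 1) \<union> (\<lambda>(i, j, c). pair_vec i j c) ` pairs"
  unfolding estimated_vecs_def by (intro Un_mono image_mono kept_subset order_refl)

lemma sum_estimated_vecs:
  fixes \<theta> :: "3 ^ 6 \<Rightarrow> 3 \<Rightarrow> real"
  shows "(\<Sum>a\<in>estimated_vecs. \<theta> a (level a x)) =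
    (\<Sum>i\<in>UNIV. \<theta> (axis i 1) (x $ i)) + (\<Sum>(i, j, c)\<in>kept. \<theta> (pair_vec i j c) (x $ i + c * x $ j))"
proof -
  have "axis i 1 \<noteq> pair_vec i' j' c" if "(i', j', c) \<in> kept" for i i' j' :: 6 and c
  proof
    assume "axis i 1 = pair_vec i' j' c"
    then have "weight (axis i 1 :: 3 ^ 6) = weight (pair_vec i' j' c)" by simp
    moreover have "weight (pair_vec i' j' c) = 2"
      using that kept_subset by (intro weight_pair_vec) (auto simp: pairs_def)
    moreover have "weight (axis i 1 :: 3 ^ 6) = 1"
      by (intro weight_axis) simp
    ultimately show False by simp
  qed
  then have "range (\<lambda>i. axis i 1) \<inter> (\<lambda>(i, j, c). pair_vec i j c) ` kept = {}"
    by auto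
  moreover have "inj (\<lambda>i. axis i 1 :: 3 ^ 6)"
    by (auto simp: inj_def axis_eq_axis)
  moreover have "inj_on (\<lambda>(i, j, c). pair_vec i j c) kept"
    using inj_on_pair_vec kept_subset by (rule inj_on_subset)
  ultimately show ?thesis
    unfolding estimated_vecs_def
    by (subst sum.union_disjoint) (auto simp: sum.reindex level_axis level_pair_vec case_prod_unfold)
qed

lemma sum_kept:
  fixes F :: "6 \<times> 6 \<times> 3 \<Rightarrow> real"
  shows "(\<Sum>t\<in>kept. F t) = F (0, 1, -1) + F (2, 3, -1) + F (4, 5, -1)
    + F (2, 4, 1) + F (2, 5, 1) + F (3, 4, 1) + F (3, 5, 1)
    + F (0, 4, 1) + F (1, 4, 1) + F (0, 5, 1) + F (1, 5, 1)
    + F (0, 2, 1) + F (0, 3, 1) + F (1, 2, 1) + F (1, 3, 1)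
    + F (0, 3, -1) + F (2, 5, -1) + F (1, 4, -1) + F (1, 3, -1) + F (3, 5, -1) + F (1, 5, -1)"
  by (simp add: kept_def)

text \<open>The response on \<open>x + shift p q\<close> splits into one part per class. Comparing
  \<open>x\<close> with 0 over all shifts separates the parts, and each class is then settled by its
  own linear system.\<close>

lemma determined_the_plan:
  fixes \<theta> :: "3 ^ 6 \<Rightarrow> 3 \<Rightarrow> real"
  assumes const: "\<And>b x y. b \<in> set the_plan \<Longrightarrow> x \<in> set b \<Longrightarrow> y \<in> set b \<Longrightarrow>
      (\<Sum>a\<in>estimated_vecs. \<theta> a (level a x)) = (\<Sum>a\<in>estimated_vecs. \<theta> a (level a y))"
    and a: "a \<in> estimated_vecs"
  shows "\<theta> a 1 = \<theta> a 0 \<and> \<theta> a 2 = \<theta> a 0"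
proof -
  define f where "f i = \<theta> (axis i 1)" for i
  define g where "g i j = \<theta> (pair_vec i j 1)" for i j
  define d where "d i j = \<theta> (pair_vec i j (- 1))" for i j
  \<comment> \<open>\<open>h0\<close> to \<open>h4\<close> are the parts of the classes of 0,
    \<open>p\<close>, \<open>q\<close>, \<open>r\<close>, \<open>p - q\<close>, with
    \<open>s\<close> the value of the restriction on the shift. Effects restricting to its negative,
    such as \<open>B + C\<close> for \<open>p\<close>, receive \<open>- s\<close>.\<close>
  define h0 where "h0 x = d 0 1 (x $ 0 - x $ 1) + d 2 3 (x $ 2 - x $ 3) + d 4 5 (x $ 4 - x $ 5)" for x :: "6 run"
  define h1 where "h1 x s = f 0 (s + x $ 0) + f 1 (s + x $ 1) + g 2 4 (x $ 2 + x $ 4 - s) + g 2 5 (x $ 2 + x $ 5 - s)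
      + g 3 4 (x $ 3 + x $ 4 - s) + g 3 5 (x $ 3 + x $ 5 - s)" for x :: "6 run" and s
  define h2 where "h2 x s = f 2 (s + x $ 2) + f 3 (s + x $ 3) + g 0 4 (x $ 4 + x $ 0 - s) + g 1 4 (x $ 4 + x $ 1 - s)
      + g 0 5 (x $ 5 + x $ 0 - s) + g 1 5 (x $ 5 + x $ 1 - s)" for x :: "6 run" and s
  define h3 where "h3 x s = f 4 (s + x $ 4) + f 5 (s + x $ 5) + g 0 2 (x $ 0 + x $ 2 - s) + g 0 3 (x $ 0 + x $ 3 - s)
      + g 1 2 (x $ 1 + x $ 2 - s) + g 1 3 (x $ 1 + x $ 3 - s)" for x :: "6 run" and s
  define h4 where "h4 x s = d 0 3 (s + (x $ 0 - x $ 3)) + d 2 5 (s + (x $ 2 - x $ 5)) + d 1 4 (x $ 1 - x $ 4 - s)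
      + d 1 3 (s + (x $ 1 - x $ 3)) + d 3 5 (s + (x $ 3 - x $ 5)) + d 1 5 (x $ 1 - x $ 5 - s)" for x :: "6 run" and s
  have total: "(\<Sum>a\<in>estimated_vecs. \<theta> a (level a (x + shift p q))) =
      h0 x + h1 x p + h2 x q + h3 x (- p - q) + h4 x (p - q)" for x p q
  proof -
    have nth: "(x + shift p q) $ 0 = x $ 0 + p" "(x + shift p q) $ 1 = x $ 1 + p" "(x + shift p q) $ 2 = x $ 2 + q"
      "(x + shift p q) $ 3 = x $ 3 + q" "(x + shift p q) $ 4 = x $ 4 + (- p - q)"
      "(x + shift p q) $ 5 = x $ 5 + (- p - q)"
      by (simp_all add: shift_def)
    have args: "u + p + - 1 * (v + p) = u - v" "u + q + - 1 * (v + q) = u - v"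
      "u + (- p - q) + - 1 * (v + (- p - q)) = u - v"
      "u + q + 1 * (v + (- p - q)) = u + v - p" "u + p + 1 * (v + (- p - q)) = v + u - q"
      "u + p + 1 * (v + q) = u + v - (- p - q)" "u + p + - 1 * (v + q) = p - q + (u - v)"
      "u + q + - 1 * (v + (- p - q)) = p - q + (u - v)" "u + p + - 1 * (v + (- p - q)) = u - v - (p - q)"
      for u v
      using three_add_self[of p] three_add_self[of q] by (simp_all add: algebra_simps)
    have "(\<Sum>i\<in>UNIV. \<theta> (axis i 1) ((x + shift p q) $ i)) = f 0 (p + x $ 0) + f 1 (p + x $ 1) + f 2 (q + x $ 2)
        + f 3 (q + x $ 3) + f 4 (- p - q + x $ 4) + f 5 (- p - q + x $ 5)"
      unfolding UNIV_6 by (simp add: f_def shift_def algebra_simps)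
    then show ?thesis
      unfolding sum_estimated_vecs sum_kept prod.case nth args h0_def h1_def h2_def h3_def h4_def
        d_def[symmetric] g_def[symmetric] by linarith
  qed
  have block: "h0 x = h0 0" "h1 x s = h1 0 s" "h2 x s = h2 0 s" "h3 x s = h3 0 s" "h4 x s = h4 0 s"
    if "B \<in> set base_blocks" "x \<in> set B" for B x s
  proof -
    have "h0 x + h1 x p + h2 x q + h3 x (- p - q) + h4 x (p - q) =
        h0 0 + h1 0 p + h2 0 q + h3 0 (- p - q) + h4 0 (p - q)" for p q
    proof -
      \<comment> \<open>Both base blocks contain 0, so \<open>x\<close> and 0 stay in a common block
        under every shift.\<close>
      have "0 \<in> set B" using that(1) by (auto simp: base_blocks_def)
      then show ?thesis
        unfolding total[symmetric] using that
        by (intro const[of "map (\<lambda>x. x + shift p q) B"])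
          (auto simp: the_plan_def intro!: map_mem_translates shift_mem)
    qed
    \<comment> \<open>The sums over \<open>s\<close> do not depend on \<open>x\<close>, which only
      translates the arguments.\<close>
    from separate_directions[where hz = "h0 x" and ha = "h1 x" and hb = "h2 x" and hc = "h3 x" and hd = "h4 x"
        and gz = "h0 0" and ga = "h1 0" and gb = "h2 0" and gc = "h3 0" and gd = "h4 0", OF this]
    show "h0 x = h0 0" "h1 x s = h1 0 s" "h2 x s = h2 0 s" "h3 x s = h3 0 s" "h4 x s = h4 0 s"
      by (simp_all add: h1_def h2_def h3_def h4_def sum.distrib sum_UNIV_shift)
  qed
  have run: "h0 x = h0 0" "h1 x s = h1 0 s" "h2 x s = h2 0 s" "h3 x s = h3 0 s" "h4 x s = h4 0 s"
    if "x \<in> {axis 2 1 - axis 1 1, axis 4 1 - axis 3 1, axis 0 1 - axis 5 1, axis 1 1, axis 3 1, axis 5 1}"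
    for x s
  proof -
    have "x \<in> set (base_blocks ! 0) \<or> x \<in> set (base_blocks ! 1)"
      "base_blocks ! 0 \<in> set base_blocks" "base_blocks ! 1 \<in> set base_blocks"
      using that by (auto simp: base_blocks_def)
    then show "h0 x = h0 0" "h1 x s = h1 0 s" "h2 x s = h2 0 s" "h3 x s = h3 0 s" "h4 x s = h4 0 s"
      using block by blast+
  qed
  have c1: "\<forall>k\<in>{f 0, f 1, g 2 4, g 2 5, g 3 4, g 3 5}. k 1 = k 0 \<and> k 2 = k 0"
    using run(2)[of "axis 2 1 - axis 1 1"] run(2)[of "axis 4 1 - axis 3 1"] run(2)[of "axis 0 1 - axis 5 1"]
      run(2)[of "axis 1 1"] run(2)[of "axis 3 1"] run(2)[of "axis 5 1"]
    by (intro main_class_determined) (simp_all add: h1_def axis_def)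
  \<comment> \<open>Functions and runs are listed in the order obtained from \<open>c1\<close> by
    the rotation, and likewise in \<open>c3\<close>.\<close>
  have c2: "\<forall>k\<in>{f 2, f 3, g 0 4, g 1 4, g 0 5, g 1 5}. k 1 = k 0 \<and> k 2 = k 0"
    using run(3)[of "axis 4 1 - axis 3 1"] run(3)[of "axis 0 1 - axis 5 1"] run(3)[of "axis 2 1 - axis 1 1"]
      run(3)[of "axis 3 1"] run(3)[of "axis 5 1"] run(3)[of "axis 1 1"]
    by (intro main_class_determined) (simp_all add: h2_def axis_def)
  have c3: "\<forall>k\<in>{f 4, f 5, g 0 2, g 0 3, g 1 2, g 1 3}. k 1 = k 0 \<and> k 2 = k 0"
    using run(4)[of "axis 0 1 - axis 5 1"] run(4)[of "axis 2 1 - axis 1 1"] run(4)[of "axis 4 1 - axis 3 1"]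
      run(4)[of "axis 5 1"] run(4)[of "axis 1 1"] run(4)[of "axis 3 1"]
    by (intro main_class_determined) (simp_all add: h3_def axis_def)
  \<comment> \<open>The reversed functions belong to \<open>C - A'\<close> and
    \<open>C' - A'\<close>, whose normalised representatives have the opposite sign.\<close>
  have c4: "\<forall>k\<in>{d 0 3, d 2 5, \<lambda>s. d 1 4 (- s), d 1 3, d 3 5, \<lambda>s. d 1 5 (- s)}. k 1 = k 0 \<and> k 2 = k 0"
    using run(5)[of "axis 2 1 - axis 1 1"] run(5)[of "axis 4 1 - axis 3 1"] run(5)[of "axis 0 1 - axis 5 1"]
      run(5)[of "axis 1 1"] run(5)[of "axis 3 1"] run(5)[of "axis 5 1"]
    by (intro difference_class_determined) (simp_all add: h4_def axis_def minus_diff_commute[of _ 1])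
  \<comment> \<open>\<open>A'\<close>, \<open>B'\<close>, \<open>C'\<close> each fix one value at 2.
    The other three runs make the differences between the values at 1 and 0 cancel in pairs around a
    3-cycle, so all three vanish.\<close>
  have c0: "\<forall>k\<in>{d 0 1, d 2 3, d 4 5}. k 1 = k 0 \<and> k 2 = k 0"
    using run(1)[of "axis 2 1 - axis 1 1"] run(1)[of "axis 4 1 - axis 3 1"] run(1)[of "axis 0 1 - axis 5 1"]
      run(1)[of "axis 1 1"] run(1)[of "axis 3 1"] run(1)[of "axis 5 1"]
    by (simp add: h0_def axis_def add_three_numerals)
  have "\<theta> (axis i 1) 1 = \<theta> (axis i 1) 0 \<and> \<theta> (axis i 1) 2 = \<theta> (axis i 1) 0" for i
    using exhaust_6[of i] c1 c2 c3 by (auto simp: f_def)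
  moreover have "\<theta> (pair_vec i j c) 1 = \<theta> (pair_vec i j c) 0 \<and> \<theta> (pair_vec i j c) 2 = \<theta> (pair_vec i j c) 0"
    if "(i, j, c) \<in> kept" for i j c
    using that c0 c1 c2 c3 c4 unfolding kept_def g_def d_def insert_iff ball_simps add_three_numerals
    by (elim disjE emptyE; simp)
  ultimately show ?thesis
    using a by (auto simp: estimated_vecs_def)
qed

theorem theorem5p4:
  "\<exists>P :: 6 plan.
     length P = 18 \<and> (\<forall>b\<in>set P. length b = 4) \<and>
     inter_class_orthogonal 4 P \<and>
     (\<exists>T \<subseteq> two_factor_interactions.
        card (two_factor_interactions - T) = 9 \<and>
        estimates P (main_effects \<union> T))"
proof (intro exI[of _ the_plan] conjI)
  let ?pv = "\<lambda>(i, j, c). pair_vec i j c :: 3 ^ 6"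
  let ?T = "effect ` ?pv ` kept"
  show "length the_plan = 18"
    by (simp add: the_plan_def translates_def base_blocks_def shifts_def)
  show "\<forall>b\<in>set the_plan. length b = 4"
    by (auto simp: the_plan_def translates_def base_blocks_def)
  show "inter_class_orthogonal 4 the_plan"
    by (rule inter_class_orthogonal_the_plan)
  have inj: "inj_on effect (?pv ` pairs)"
    using inj_on_effect by (rule inj_on_subset) auto
  \<comment> \<open>Injectivity carries the complement back to index triples, where the nine missing
    ones are listed.\<close>
  then have "two_factor_interactions - ?T = effect ` (?pv ` pairs - ?pv ` kept)"
    unfolding two_factor_interactions_eq using kept_subset
    by (subst inj_on_image_set_diff[of effect "?pv ` pairs"]) (auto intro!: image_mono)
  also have "?pv ` pairs - ?pv ` kept = ?pv ` (pairs - kept)"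
    using kept_subset by (subst inj_on_image_set_diff[OF inj_on_pair_vec]) auto
  finally have "card (two_factor_interactions - ?T) = card (pairs - kept :: (6 \<times> 6 \<times> 3) set)"
    using inj_on_subset[OF inj, of "?pv ` (pairs - kept)"] inj_on_subset[OF inj_on_pair_vec, of "pairs - kept"]
    by (simp add: card_image image_mono)
  also have "pairs - kept = {(0, 1, 1), (2, 3, 1), (4, 5, 1), (0, 2, - 1), (2, 4, - 1), (0, 4, - 1),
      (1, 2, - 1), (3, 4, - 1), (0, 5, - 1 :: 3)}"
    unfolding pairs_6 by (auto simp: kept_def)
  also have "card \<dots> = 9"
    by simp
  finally have "card (two_factor_interactions - ?T) = 9" .
  moreover have "main_effects \<union> ?T = effect ` estimated_vecs"
    unfolding main_effects_eq estimated_vecs_def by (simp add: image_Un)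
  moreover have "estimates the_plan (effect ` estimated_vecs)"
    using inj_on_subset[OF inj_on_effect estimated_vecs_subset] determined_the_plan
    by (rule estimates_imageI)
  ultimately show "\<exists>T \<subseteq> two_factor_interactions.
      card (two_factor_interactions - T) = 9 \<and> estimates the_plan (main_effects \<union> T)"
    using kept_subset unfolding two_factor_interactions_eq by (intro exI[of _ ?T]) (simp add: image_mono)
qed

end
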